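(* Let $p<q$ be primes, given together with $s=\lfloor q/p\rfloor$ and $r=q\bmod p$. The BCW algorithm computes the cyclotomic word $\boldsymbol{a}_{pq}$ in $\Theta(pq)$ operations. More precisely: (a) the precomputation phase depends only on the pair $(p,r)$ and its cost is $\Theta(p^2)$; (b) the computation phase performs $s(p-2)$ concatenations of words of length $p$, and its cost is $\Theta(pq)$.
   Context: Let $\mathcal{A}=\{-1,0,1\}$. The cyclotomic word $\boldsymbol{a}_{pq}\in\mathcal{A}^{\varphi(pq)+1}$ is the sequence of coefficients $a_0,\dots,a_{\varphi(pq)}$ of the cyclotomic polynomial $\Phi_{pq}(x)=\sum a_ix^i$. Notation on words: $\cdot$ is concatenation, $\boldsymbol{v}^s$ the $s$-fold concatenation; for $\boldsymbol{v}\in\mathcal{A}^p$ and $k\ge0$, $\boldsymbol{v}^{k/p}\in\mathcal{A}^k$ is the prefix of length $k$ of $\boldsymbol{v}$ if $k<p$ and $\boldsymbol{v}^{\lfloor k/p\rfloor}\cdot\boldsymbol{v}^{(k\bmod p)/p}$ if $k\ge p$; $\sigma(v_0\cdots v_{p-1})=v_1\cdots v_{p-1}v_0$; addition of words is coordinatewise. The BCW algorithm: Precomputation phase: (i) compute $\boldsymbol{d}_0=1(-1)0\cdots0\in\mathcal{A}^p$ and $\boldsymbol{d}_i=\sigma^{q}(\boldsymbol{d}_{i-1})=\sigma^{r}(\boldsymbol{d}_{i-1})$ for $1\le i\le p-2$; (ii) compute $\boldsymbol{\omega}_0=\boldsymbol{d}_0$, $\boldsymbol{\omega}_i=\boldsymbol{\omega}_{i-1}+\boldsymbol{d}_i$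 and the prefixes $\boldsymbol{\omega}_i^{r/p}$ for $0\le i\le p-2$. Computation phase: form $\boldsymbol{b}_{pq}=\boldsymbol{\omega}_0^s\cdot\boldsymbol{\omega}_0^{r/p}\cdots\boldsymbol{\omega}_{p-2}^s\cdot\boldsymbol{\omega}_{p-2}^{r/p}$ by concatenation, and output $\boldsymbol{a}_{pq}$ obtained by deleting the suffix of length $p-2$ of $\boldsymbol{b}_{pq}$. Cost model: each of the word operations (cyclic permutation, truncation, internal addition, concatenation) applied to a word of length at most $p$ costs $\Theta(p)$ elementary operations on symbols of $\mathcal{A}$; cost means the total number of such elementary operations.
   Formalization: The count s(p-2) in (b) is wrong as a total (p=2, q=5 would give 0): the formal statement proves that s(p-1) words of length p are concatenated in all, and that s(p-2) of these are appended after the first block (of length q) is complete. *)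

theory Defs
  imports
    Complex_Main
    "HOL-Computational_Algebra.Polynomial"
    "HOL-Number_Theory.Totient"
    "HOL-Library.Landau_Symbols"
begin

definition cyclotomic_poly :: "nat \<Rightarrow> complex poly" where
  "cyclotomic_poly n =
     (\<Prod>k | k \<in> {1..n} \<and> coprime k n. [:- cis (2 * pi * real k / real n), 1:])"

definition cyclotomic_word :: "nat \<Rightarrow> complex list" where
  "cyclotomic_word n = map (coeff (cyclotomic_poly n)) [0..<totient n + 1]"

type_synonym word = "int list"

definition alphabet :: "int set" where
  "alphabet = {-1, 0, 1}"

text \<open>
  The operations executed by an algorithm are recorded in a log, together with the words they are
  applied to. \<open>Suffix_Deletion k w\<close> is the truncation that removes the last \<open>k\<close> letters of \<open>w\<close>.
\<close>

datatype word_op =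
    Cyclic_Permutation word
  | Truncation nat word
  | Internal_Addition word word
  | Concatenation word word
  | Suffix_Deletion nat word

fun op_words :: "word_op \<Rightarrow> word set" where
  "op_words (Cyclic_Permutation w) = {w}"
| "op_words (Truncation k w) = {w}"
| "op_words (Internal_Addition u v) = {u, v}"
| "op_words (Concatenation u v) = {u, v}"
| "op_words (Suffix_Deletion k w) = {w}"

text \<open>
  The length of the word an operation is regarded as being applied to. Concatenation extends the
  word \<open>u\<close> built so far by the letters of \<open>v\<close> only, and suffix deletion touches only the deleted
  letters.
\<close>

fun op_length :: "word_op \<Rightarrow> nat" where
  "op_length (Cyclic_Permutation w) = length w"
| "op_length (Truncation k w) = length w"
| "op_length (Internal_Addition u v) = max (length u) (length v)"
| "op_length (Concatenation u v) = length v"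
| "op_length (Suffix_Deletion k w) = k"

text \<open>
  \<open>cost p x\<close> is the number of elementary operations on letters needed for \<open>x\<close> when
  the algorithm is run with the prime \<open>p\<close>. Landau symbols over a principal filter have constants that
  are uniform over the given set.
\<close>

definition cost_model :: "(nat \<Rightarrow> word_op \<Rightarrow> nat) \<Rightarrow> bool" where
  "cost_model cost \<longleftrightarrow>
     (\<lambda>(p, x). real (cost p x))
       \<in> \<Theta>[principal {(p, x). prime p \<and> op_length x \<le> p \<and> op_words x \<subseteq> lists alphabet}](\<lambda>(p, x). real p)"

type_synonym 'a logged = "'a \<times> word_op list"

definition ret :: "'a \<Rightarrow> 'a logged" where
  "ret x = (x, [])"

definition andthen :: "'a logged \<Rightarrow> ('a \<Rightarrow> 'b logged) \<Rightarrow> 'b logged" (infixr \<open>\<bind>\<^sub>l\<close> 54) where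
  "m \<bind>\<^sub>l f = (fst (f (fst m)), snd m @ snd (f (fst m)))"

definition cyclic_permutation :: "nat \<Rightarrow> word \<Rightarrow> word logged" where
  "cyclic_permutation k w = (rotate k w, [Cyclic_Permutation w])"

definition truncation :: "nat \<Rightarrow> word \<Rightarrow> word logged" where
  "truncation k w = (take k w, [Truncation k w])"

definition internal_addition :: "word \<Rightarrow> word \<Rightarrow> word logged" where
  "internal_addition u v = (map2 (+) u v, [Internal_Addition u v])"

definition concatenation :: "word \<Rightarrow> word \<Rightarrow> word logged" where
  "concatenation u v = (u @ v, [Concatenation u v])"

definition suffix_deletion :: "nat \<Rightarrow> word \<Rightarrow> word logged" where
  "suffix_deletion k w = (take (length w - k) w, [Suffix_Deletion k w])"

text \<open>\<open>d, \<sigma>\<^sup>q d, \<dots>, \<sigma>\<^bsup>qn\<^esup> d\<close>\<close>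

primrec bcw_shifts :: "nat \<Rightarrow> nat \<Rightarrow> word \<Rightarrow> word list logged" where
  "bcw_shifts q 0 d = ret [d]"
| "bcw_shifts q (Suc n) d =
     cyclic_permutation q d \<bind>\<^sub>l (\<lambda>d'. bcw_shifts q n d' \<bind>\<^sub>l (\<lambda>ds. ret (d # ds)))"

primrec bcw_sums :: "word \<Rightarrow> word list \<Rightarrow> word list logged" where
  "bcw_sums w [] = ret [w]"
| "bcw_sums w (d # ds) =
     internal_addition w d \<bind>\<^sub>l (\<lambda>w'. bcw_sums w' ds \<bind>\<^sub>l (\<lambda>ws. ret (w # ws)))"

primrec bcw_prefixes :: "nat \<Rightarrow> word list \<Rightarrow> word list logged" where
  "bcw_prefixes r [] = ret []"
| "bcw_prefixes r (w # ws) =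
     truncation r w \<bind>\<^sub>l (\<lambda>u. bcw_prefixes r ws \<bind>\<^sub>l (\<lambda>us. ret (u # us)))"

text \<open>The result is the list of pairs \<open>(\<omega>\<^sub>i, \<omega>\<^sub>i\<^bsup>r/p\<^esup>)\<close> for \<open>0 \<le> i \<le> p - 2\<close>; here \<open>r < p\<close>, so
  \<open>\<omega>\<^sub>i\<^bsup>r/p\<^esup>\<close> is a plain prefix.\<close>

definition bcw_precomputation :: "nat \<Rightarrow> nat \<Rightarrow> nat \<Rightarrow> (word \<times> word) list logged" where
  "bcw_precomputation p q r =
     bcw_shifts q (p - 2) ([1, -1] @ replicate (p - 2) 0) \<bind>\<^sub>l (\<lambda>ds.
     bcw_sums (hd ds) (tl ds) \<bind>\<^sub>l (\<lambda>ws.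
     bcw_prefixes r ws \<bind>\<^sub>l (\<lambda>us.
     ret (zip ws us))))"

primrec append_copies :: "nat \<Rightarrow> word \<Rightarrow> word \<Rightarrow> word logged" where
  "append_copies 0 w b = ret b"
| "append_copies (Suc n) w b = concatenation b w \<bind>\<^sub>l append_copies n w"

primrec append_blocks :: "nat \<Rightarrow> (word \<times> word) list \<Rightarrow> word \<Rightarrow> word logged" where
  "append_blocks s [] b = ret b"
| "append_blocks s (x # xs) b =
     append_copies s (fst x) b \<bind>\<^sub>l (\<lambda>b'.
     concatenation b' (snd x) \<bind>\<^sub>l
     append_blocks s xs)"

definition bcw_computation :: "nat \<Rightarrow> nat \<Rightarrow> (word \<times> word) list \<Rightarrow> word logged" where
  "bcw_computation p s xs = append_blocks s xs [] \<bind>\<^sub>l suffix_deletion (p - 2)"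

definition bcw :: "nat \<Rightarrow> nat \<Rightarrow> nat \<Rightarrow> nat \<Rightarrow> word logged" where
  "bcw p q s r = bcw_precomputation p q r \<bind>\<^sub>l bcw_computation p s"

definition bcw_inputs :: "(nat \<times> nat \<times> nat \<times> nat) set" where
  "bcw_inputs = {(p, q, s, r). prime p \<and> prime q \<and> p < q \<and> s = q div p \<and> r = q mod p}"

definition total_cost :: "(nat \<Rightarrow> word_op \<Rightarrow> nat) \<Rightarrow> nat \<Rightarrow> 'a logged \<Rightarrow> nat" where
  "total_cost cost p m = (\<Sum>x\<leftarrow>snd m. cost p x)"

text \<open>
  In the computation phase every block \<open>\<omega>\<^sub>i\<^sup>s \<cdot> \<omega>\<^sub>i\<^bsup>r/p\<^esup>\<close> has length \<open>q\<close>, so a concatenation to a word \<open>u\<close> with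
  \<open>q \<le> length u\<close> is one that happens after the first block is complete.
\<close>

definition num_concatenations :: "(word \<Rightarrow> word \<Rightarrow> bool) \<Rightarrow> 'a logged \<Rightarrow> nat" where
  "num_concatenations P m =
     length (filter (\<lambda>x. case x of Concatenation u v \<Rightarrow> P u v | _ \<Rightarrow> False) (snd m))"

end

theory Submission
  imports Defs
begin

text \<open>
  From \<open>\<Phi>\<^sub>p\<^sub>q (x\<^sup>p - 1) (x\<^sup>q - 1) = (x - 1) (x\<^bsup>pq\<^esup> - 1)\<close> one gets, as power series,
  \<open>\<Phi>\<^sub>p\<^sub>q = (1 - x) / (1 - x\<^sup>p) \<cdot> \<Sum>\<^bsub>j<p\<^esub> x\<^bsup>jq\<^esup>\<close>. The first factor has the \<open>p\<close>-periodic
  coefficient sequence with period \<open>1, -1, 0, \<dots>, 0\<close>, so the coefficient of \<open>x\<^bsup>iq+n\<^esup>\<close> with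
  \<open>n < q\<close> is the sum over \<open>j \<le> i\<close> of this sequence at \<open>n + jq\<close>, i.e. the letter of
  \<open>\<omega>\<^sub>i\<close> at \<open>n mod p\<close>. Since \<open>q\<close> is invertible modulo \<open>p\<close>, at most one summand is \<open>1\<close> and at most
  one is \<open>-1\<close>, so all words stay in the alphabet and every logged operation costs \<open>\<Theta>(p)\<close>. The two
  phases execute \<open>3p - 5\<close> and \<open>(p - 1)(s + 1) + 1\<close> operations.
\<close>

section \<open>Factorization of the cyclotomic polynomial of order pq\<close>

text \<open>Both sides are monic of degree \<open>n\<close> and vanish at the \<open>n\<close>
  distinct \<open>n\<close>-th roots of unity.\<close>

lemma prod_roots_of_unity:
  assumes "n > 0"
  shows "(\<Prod>k=1..n. [:- cis (2 * pi * real k / real n), 1:]) = monom 1 n - 1"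
proof (rule poly_eqI_degree_lead_coeff[where n = n and A = "{z. z ^ n = 1}"])
  let ?P = "\<Prod>k=1..n. [:- cis (2 * pi * real k / real n), 1:]"
  have deg: "degree ?P = n"
    by (subst degree_prod_eq_sum_degree) auto
  have "lead_coeff ?P = 1"
    by (simp add: lead_coeff_prod)
  with deg assms show "coeff ?P n = coeff (monom 1 n - 1) n"
    by (simp add: coeff_1)
  show "degree ?P \<le> n" using deg by simp
  show "n \<le> card {z::complex. z ^ n = 1}" using assms by (simp add: card_roots_unity_eq)
  show "degree (monom 1 n - 1 :: complex poly) \<le> n"
    by (intro degree_diff_le) (auto simp: degree_monom_le)
  fix z :: complex assume z: "z \<in> {z. z ^ n = 1}"
  then obtain k where k: "k < n" "z = cis (2 * pi * real k / real n)"
    using bij_betw_imp_surj_on[OF bij_betw_roots_unity[OF assms]] by blast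
  \<comment> \<open>The roots are enumerated by \<open>0..n-1\<close>, the factors by
    \<open>1..n\<close>; index 0 is moved to \<open>n\<close>, which gives the same root.\<close>
  define k' where "k' = (if k = 0 then n else k)"
  have "k' \<in> {1..n}" "z = cis (2 * pi * real k' / real n)"
    using k assms by (auto simp: k'_def)
  then have "poly ?P z = 0" by (auto simp: poly_prod)
  then show "poly ?P z = poly (monom 1 n - 1) z" using z by (simp add: poly_monom)
qed

text \<open>The indices in \<open>{1..p * q}\<close> not coprime to \<open>p * q\<close> are the
  multiples of \<open>p\<close> (set \<open>A\<close>) and of \<open>q\<close> (set
  \<open>B\<close>). The products over \<open>A\<close> and \<open>B\<close> give
  \<open>x^q - 1\<close> and \<open>x^p - 1\<close>; the only common index \<open>p * q\<close>
  contributes the extra factor \<open>x - 1\<close>.\<close>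

lemma cyclotomic_poly_prime_mult:
  assumes "prime p" "prime q" "p \<noteq> q"
  shows "cyclotomic_poly (p * q) * (monom 1 p - 1) * (monom 1 q - 1) = [:-1, 1:] * (monom 1 (p * q) - 1)"
proof -
  define R where "R k = [:- cis (2 * pi * real k / real (p * q)), 1:]" for k
  define A where "A = (\<lambda>k. p * k) ` {1..q}"
  define B where "B = (\<lambda>k. q * k) ` {1..p}"
  have pos: "p > 0" "q > 0" using assms prime_gt_0_nat by auto
  have cop: "coprime p q" using assms primes_coprime by blast
  have A_iff: "k \<in> A \<longleftrightarrow> k \<in> {1..p * q} \<and> p dvd k" for k
    using pos by (auto simp: A_def image_iff elim!: dvdE)
  have B_iff: "k \<in> B \<longleftrightarrow> k \<in> {1..p * q} \<and> q dvd k" for k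
    using pos by (auto simp: B_def image_iff mult.commute elim!: dvdE)
  have fin: "finite A" "finite B" by (auto simp: A_def B_def)
  have inter: "A \<inter> B = {p * q}"
  proof -
    have "k = p * q" if "k \<in> A" "k \<in> B" for k
      using that divides_mult[OF _ _ cop, of k] by (auto simp: A_iff B_iff intro: le_antisym dvd_imp_le)
    moreover have "p * q \<in> A" "p * q \<in> B"
      using pos by (auto simp: A_iff B_iff)
    ultimately show ?thesis by blast
  qed
  have coprime_iff: "coprime k x \<longleftrightarrow> \<not> x dvd k" if "prime x" for k x :: nat
    using that by (metis coprime_commute coprime_absorb_left not_prime_unit prime_imp_coprime)
  have union: "A \<union> B = {1..p * q} - {k \<in> {1..p * q}. coprime k (p * q)}"
    unfolding set_eq_iff Un_iff Diff_iff mem_Collect_eq A_iff B_iff coprime_mult_right_iff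
      coprime_iff[OF assms(1)] coprime_iff[OF assms(2)] by blast
  have PA: "prod R A = monom 1 q - 1"
  proof -
    have "prod R A = (\<Prod>k=1..q. R (p * k))"
      unfolding A_def using pos by (subst prod.reindex) (auto simp: inj_on_def)
    also have "\<dots> = (\<Prod>k=1..q. [:- cis (2 * pi * real k / real q), 1:])"
      using pos by (intro prod.cong) (auto simp: R_def mult.assoc)
    finally show ?thesis using prod_roots_of_unity[OF pos(2)] by simp
  qed
  have PB: "prod R B = monom 1 p - 1"
  proof -
    have "prod R B = (\<Prod>k=1..p. R (q * k))"
      unfolding B_def using pos by (subst prod.reindex) (auto simp: inj_on_def)
    also have "\<dots> = (\<Prod>k=1..p. [:- cis (2 * pi * real k / real p), 1:])"
      using pos by (intro prod.cong) (auto simp: R_def mult.assoc)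
    finally show ?thesis using prod_roots_of_unity[OF pos(1)] by simp
  qed
  have R_pq: "R (p * q) = [:-1, 1:]"
    using pos by (simp add: R_def)
  have "monom 1 (p * q) - 1 = prod R {1..p * q}"
    using prod_roots_of_unity[of "p * q"] pos by (simp add: R_def)
  also have "\<dots> = prod R (A \<union> B) * cyclotomic_poly (p * q)"
    unfolding union cyclotomic_poly_def R_def by (rule prod.subset_diff) auto
  finally have "[:-1, 1:] * (monom 1 (p * q) - 1)
      = (prod R (A \<union> B) * prod R (A \<inter> B)) * cyclotomic_poly (p * q)"
    by (simp only: inter prod.insert prod.empty finite.emptyI empty_iff not_False_eq_True mult_1_left mult_1_right R_pq mult_ac)
  also have "\<dots> = cyclotomic_poly (p * q) * (monom 1 p - 1) * (monom 1 q - 1)"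
    by (subst prod.union_inter[OF fin]) (simp add: PA PB mult_ac)
  finally show ?thesis by simp
qed

text \<open>Dividing \<open>x^(pq) - 1\<close> by \<open>x^q - 1\<close> leaves a geometric sum.
  Comparing coefficients in the result gives a recurrence with step \<open>p\<close>.\<close>

lemma cyclotomic_poly_prime_mult_eq_sum:
  assumes "prime p" "prime q" "p \<noteq> q"
  shows "cyclotomic_poly (p * q) * (monom 1 p - 1) = [:-1, 1:] * (\<Sum>j<p. monom 1 (j * q))"
proof -
  have q: "q > 0" using assms prime_gt_0_nat by auto
  have "monom 1 (p * q) - 1 = (monom 1 q - 1) * (\<Sum>j<p. monom (1::complex) (j * q))"
    using power_diff_1_eq[of "monom (1::complex) q" p] by (simp add: monom_power mult.commute)
  then have "(cyclotomic_poly (p * q) * (monom 1 p - 1)) * (monom 1 q - 1)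
     = ([:-1, 1:] * (\<Sum>j<p. monom 1 (j * q))) * (monom 1 q - 1)"
    using cyclotomic_poly_prime_mult[OF assms] by (simp add: mult_ac)
  moreover have "monom 1 q - 1 \<noteq> (0 :: complex poly)"
    using q by (simp add: monom_eq_1_iff)
  ultimately show ?thesis by (simp only: mult_cancel_right) simp
qed

section \<open>Coefficients as sums of shifted periodic sequences\<close>

definition base_letter :: "nat \<Rightarrow> nat \<Rightarrow> int" where
  "base_letter p n = (if n mod p = 0 then 1 else if n mod p = 1 then -1 else 0)"

text \<open>This is \<open>(1 - x^p) * ((1 - x) / (1 - x^p)) = 1 - x\<close>, read off
  coefficientwise. The bound on \<open>p\<close> keeps the residues 0 and 1 apart.\<close>

lemma base_letter_rec:
  assumes "p \<ge> 2"
  shows "base_letter p n = (if n < p then 0 else base_letter p (n - p)) +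
    ((if n = 0 then 1 else 0) - (if n = 1 then 1 else 0))"
  using assms by (auto simp: base_letter_def le_mod_geq)

text \<open>No power series are used: both sides satisfy the same recurrence with step
  \<open>p\<close>, whose inhomogeneous term, the sum of the \<open>e m j\<close>, is the
  coefficient of \<open>x^m\<close> in \<open>(1 - x)\<close> times the sum of the
  \<open>x^(jq)\<close>. Strong induction on \<open>m\<close> concludes.\<close>

lemma coeff_cyclotomic_poly_prime_mult:
  assumes "prime p" "prime q" "p \<noteq> q"
  shows "coeff (cyclotomic_poly (p * q)) m =
    of_int (\<Sum>j | j < p \<and> j * q \<le> m. base_letter p (m - j * q))"
proof -
  define c where "c = coeff (cyclotomic_poly (p * q))"
  define f where "f m j = (if j * q \<le> m then base_letter p (m - j * q) else 0)" for m j
  define e where "e m j = (if m = j * q then 1 else 0) - (if m = Suc (j * q) then 1 else (0::int))" for m j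
  have p: "p \<ge> 2" using assms prime_ge_2_nat by blast
  have c_rec: "c m = (if m < p then 0 else c (m - p)) + of_int (\<Sum>j<p. e m j)" for m
  proof -
    have "coeff (cyclotomic_poly (p * q) * (monom 1 p - 1)) m
        = coeff ([:-1, 1:] * (\<Sum>j<p. monom 1 (j * q))) m"
      by (simp only: cyclotomic_poly_prime_mult_eq_sum[OF assms])
    moreover have "coeff (cyclotomic_poly (p * q) * (monom 1 p - 1)) m = (if m < p then 0 else c (m - p)) - c m"
      by (simp add: c_def right_diff_distrib coeff_monom_mult mult.commute[of _ "monom 1 p"])
    moreover have "coeff ([:-1, 1:] * (\<Sum>j<p. monom 1 (j * q))) m = of_int (\<Sum>j<p. - e m j)"
      by (cases m) (auto simp: e_def coeff_sum coeff_pCons simp flip: sum_subtractf sum_negf sum.distrib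
          intro!: sum.cong)
    ultimately have "(if m < p then 0 else c (m - p)) - c m = - of_int (\<Sum>j<p. e m j)"
      by (simp only: sum_negf of_int_minus)
    moreover have "b = a + x" if "a - b = - x" for a b x :: complex
      using that by (simp add: algebra_simps)
    ultimately show ?thesis by blast
  qed
  have f_rec: "f m j = (if m < p then 0 else f (m - p) j) + e m j" for m j
  proof (cases "j * q \<le> m")
    case True
    then obtain n where n: "m = j * q + n" using le_Suc_ex by blast
    show ?thesis
    proof (cases "n < p")
      case True
      \<comment> \<open>Even if \<open>p \<le> m\<close>, here \<open>m - p < j * q\<close>, so
        \<open>f (m - p) j\<close> is 0.\<close>
      then show ?thesis using base_letter_rec[OF p, of n] p by (auto simp: f_def e_def n)
    next
      case False
      then have "m - p = j * q + (n - p)" "\<not> m < p" by (auto simp: n)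
      then show ?thesis using base_letter_rec[OF p, of n] False p by (simp add: f_def e_def n)
    qed
  next
    case False
    then show ?thesis by (auto simp: f_def e_def)
  qed
  have "c m = of_int (\<Sum>j<p. f m j)"
  proof (induction m rule: less_induct)
    case (less m)
    have "(\<Sum>j<p. f m j) = (if m < p then 0 else \<Sum>j<p. f (m - p) j) + (\<Sum>j<p. e m j)"
      by (subst f_rec) (auto simp: sum.distrib)
    with less[of "m - p"] p show ?case by (subst c_rec) auto
  qed
  also have "(\<Sum>j<p. f m j) = (\<Sum>j | j < p \<and> j * q \<le> m. base_letter p (m - j * q))"
    unfolding f_def by (subst sum.inter_filter[symmetric]) (auto intro: sum.cong)
  finally show ?thesis by (simp add: c_def)
qed

lemma base_letter_cong: "m mod p = n mod p \<Longrightarrow> base_letter p m = base_letter p n"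
  by (simp add: base_letter_def)

section \<open>The words \<open>\<omega>\<^sub>i\<close> and their alphabet\<close>

text \<open>The position \<open>n\<close> is not restricted to \<open>n < p\<close>, so the same
  function describes both \<open>\<omega>\<^sub>i\<close> and the whole block of length
  \<open>q\<close> made from it.\<close>

definition omega_letter :: "nat \<Rightarrow> nat \<Rightarrow> nat \<Rightarrow> nat \<Rightarrow> int" where
  "omega_letter p q i n = (\<Sum>j\<le>i. base_letter p (n + j * q))"

definition omega_word :: "nat \<Rightarrow> nat \<Rightarrow> nat \<Rightarrow> word" where
  "omega_word p q i = map (omega_letter p q i) [0..<p]"

lemma length_omega_word [simp]: "length (omega_word p q i) = p"
  by (simp add: omega_word_def)

lemma omega_letter_mod: "omega_letter p q i (n mod p) = omega_letter p q i n"
  unfolding omega_letter_def by (intro sum.cong refl base_letter_cong) (simp add: mod_add_left_eq)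

text \<open>The residues of \<open>n + j * q\<close> modulo \<open>p\<close> are distinct for
  \<open>j \<le> i < p\<close>. Hence each of the residues 0 and 1 occurs at most once, and the sum
  is a difference of two numbers from {0, 1}.\<close>

lemma omega_letter_in_alphabet:
  assumes "coprime p q" "i < p"
  shows "omega_letter p q i n \<in> alphabet"
proof -
  have inj: "inj_on (\<lambda>j. (n + j * q) mod p) {..i}"
  proof (rule inj_onI)
    fix j k assume "j \<in> {..i}" "k \<in> {..i}" and eq: "(n + j * q) mod p = (n + k * q) mod p"
    from eq have "[j * q = k * q] (mod p)"
      by (simp flip: cong_def add: cong_add_lcancel_nat)
    then have "[j = k] (mod p)"
      using assms(1) by (simp add: cong_mult_rcancel_nat coprime_commute)
    then show "j = k"
      using \<open>j \<in> _\<close> \<open>k \<in> _\<close> assms(2) by (auto intro: cong_less_modulus_unique_nat)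
  qed
  have le: "card {j \<in> {..i}. (n + j * q) mod p = c} \<le> 1" for c
    unfolding One_nat_def using inj by (subst card_le_Suc0_iff_eq) (auto dest: inj_onD)
  have "omega_letter p q i n =
      (\<Sum>j\<le>i. (if (n + j * q) mod p = 0 then 1 else 0) - (if p \<noteq> 1 \<and> (n + j * q) mod p = 1 then 1 else 0))"
    unfolding omega_letter_def base_letter_def by (intro sum.cong) auto
  also have "\<dots> = int (card {j \<in> {..i}. (n + j * q) mod p = 0}) -
      int (card {j \<in> {..i}. p \<noteq> 1 \<and> (n + j * q) mod p = 1})"
    by (simp add: sum_subtractf flip: sum.inter_filter)
  finally have "omega_letter p q i n = \<dots>" .
  moreover have "card {j \<in> {..i}. p \<noteq> 1 \<and> (n + j * q) mod p = 1} \<le> 1"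
    using le[of 1] by (cases "p = 1") auto
  moreover have "int a - int b \<in> alphabet" if "a \<le> 1" "b \<le> 1" for a b
    using that by (auto simp: alphabet_def)
  ultimately show ?thesis using le[of 0] by presburger
qed

lemma set_omega_word:
  assumes "coprime p q" "i < p"
  shows "set (omega_word p q i) \<subseteq> alphabet"
  using omega_letter_in_alphabet[OF assms] by (auto simp: omega_word_def)

section \<open>Results and log of the precomputation phase\<close>

lemma fst_ret [simp]: "fst (ret x) = x" and snd_ret [simp]: "snd (ret x) = []"
  by (simp_all add: ret_def)

lemma fst_andthen [simp]: "fst (m \<bind>\<^sub>l f) = fst (f (fst m))"
  and snd_andthen [simp]: "snd (m \<bind>\<^sub>l f) = snd m @ snd (f (fst m))"
  by (simp_all add: andthen_def)

lemma fst_bcw_shifts: "fst (bcw_shifts q n d) = map (\<lambda>i. rotate (i * q) d) [0..<Suc n]"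
  by (induction n arbitrary: d)
    (simp_all add: cyclic_permutation_def rotate_rotate map_upt_Suc add.commute del: upt_Suc)

lemma snd_bcw_shifts: "snd (bcw_shifts q n d) = map (\<lambda>i. Cyclic_Permutation (rotate (i * q) d)) [0..<n]"
  by (induction n arbitrary: d)
    (simp_all add: cyclic_permutation_def rotate_rotate map_upt_Suc add.commute del: upt_Suc)

text \<open>The first operand of each addition is the sum reached so far. The list of sums is longer
  by one than \<open>ds\<close>; \<open>map2\<close> drops the last sum, to which nothing is
  added.\<close>

lemma snd_bcw_sums: "snd (bcw_sums w ds) = map2 Internal_Addition (fst (bcw_sums w ds)) ds"
  by (induction ds arbitrary: w) (simp_all add: internal_addition_def)

text \<open>The start \<open>a\<close> is general because each addition turns the partial sum up to
  \<open>a\<close> into the one up to \<open>Suc a\<close>, and the recursion continues from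
  there.\<close>

lemma fst_bcw_sums_partial_sums:
  "fst (bcw_sums (map (\<lambda>k. \<Sum>j\<le>a. g j k) [0..<p]) (map (\<lambda>i. map (g i) [0..<p]) [Suc a..<Suc a + n]))
    = map (\<lambda>i. map (\<lambda>k. \<Sum>j\<le>i. g j k) [0..<p]) [a..<Suc a + n]"
proof (induction n arbitrary: a)
  case (Suc n)
  have "map2 (+) (map (\<lambda>k. \<Sum>j\<le>a. g j k) [0..<p]) (map (g (Suc a)) [0..<p])
      = map (\<lambda>k. \<Sum>j\<le>Suc a. g j k) [0..<p]"
    by (simp add: map2_map_map)
  then show ?case
    using Suc[of "Suc a"] by (simp add: upt_conv_Cons internal_addition_def del: upt_Suc sum.atMost_Suc)
qed simp

lemma fst_bcw_prefixes: "fst (bcw_prefixes r ws) = map (take r) ws"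
  by (induction ws) (simp_all add: truncation_def)

lemma snd_bcw_prefixes: "snd (bcw_prefixes r ws) = map (Truncation r) ws"
  by (induction ws) (simp_all add: truncation_def)

lemma base_word_eq:
  assumes "p \<ge> 2"
  shows "[1, -1] @ replicate (p - 2) 0 = map (base_letter p) [0..<p]"
proof (rule nth_equalityI)
  fix k assume "k < length ([1, -1] @ replicate (p - 2) (0::int))"
  then have "k < p" using assms by simp
  then show "([1, -1] @ replicate (p - 2) 0) ! k = map (base_letter p) [0..<p] ! k"
    using assms by (auto simp: base_letter_def nth_Cons nth_append split: nat.split)
qed (use assms in simp)

lemma rotate_base_word:
  "rotate m (map (base_letter p) [0..<p]) = map (\<lambda>k. base_letter p (k + m)) [0..<p]"
  by (rule nth_equalityI) (auto simp: nth_rotate add.commute intro!: base_letter_cong)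

text \<open>The explicit log serves two purposes: its length counts the operations, and its entries
  show the words they are applied to.\<close>

lemma bcw_precomputation_eq:
  assumes "p \<ge> 2"
  shows "fst (bcw_precomputation p q r)
           = map (\<lambda>i. (omega_word p q i, take r (omega_word p q i))) [0..<p - 1]" (is ?result)
    and "snd (bcw_precomputation p q r) =
           map (\<lambda>i. Cyclic_Permutation (map (\<lambda>k. base_letter p (k + i * q)) [0..<p])) [0..<p - 2] @
           map (\<lambda>i. Internal_Addition (omega_word p q i) (map (\<lambda>k. base_letter p (k + Suc i * q)) [0..<p])) [0..<p - 2] @
           map (\<lambda>i. Truncation r (omega_word p q i)) [0..<p - 1]" (is ?log)
proof -
  define d where "d i = map (\<lambda>k. base_letter p (k + i * q)) [0..<p]" for i
  define ds where "ds = bcw_shifts q (p - 2) ([1, -1] @ replicate (p - 2) 0)"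
  have p: "Suc (p - 2) = p - 1" using assms by simp
  have fst_ds: "fst ds = map d [0..<p - 1]"
    unfolding ds_def d_def fst_bcw_shifts p using assms by (simp only: base_word_eq rotate_base_word)
  have snd_ds: "snd ds = map (\<lambda>i. Cyclic_Permutation (d i)) [0..<p - 2]"
    unfolding ds_def d_def snd_bcw_shifts using assms by (simp only: base_word_eq rotate_base_word)
  have "[0..<p - 1] = 0 # [Suc 0..<p - 1]"
    using assms by (simp add: upt_conv_Cons)
  then have hd: "hd (fst ds) = d 0" and tl: "tl (fst ds) = map d [Suc 0..<p - 1]"
    by (simp_all add: fst_ds)
  have fst_ws: "fst (bcw_sums (d 0) (map d [Suc 0..<p - 1])) = map (omega_word p q) [0..<p - 1]"
    using fst_bcw_sums_partial_sums[of "\<lambda>i k. base_letter p (k + i * q)" 0 p "p - 2"]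
    unfolding p[symmetric] d_def omega_word_def omega_letter_def by (simp del: upt_Suc)
  have snd_ws: "snd (bcw_sums (d 0) (map d [Suc 0..<p - 1]))
      = map (\<lambda>i. Internal_Addition (omega_word p q i) (d (Suc i))) [0..<p - 2]"
    unfolding snd_bcw_sums fst_ws by (rule nth_equalityI) (use assms in auto)
  show ?result
    unfolding bcw_precomputation_def ds_def[symmetric] fst_andthen hd tl fst_ws fst_bcw_prefixes fst_ret
    by (simp add: zip_map_map zip_same_conv_map)
  show ?log
    unfolding bcw_precomputation_def ds_def[symmetric] snd_andthen hd tl fst_ws snd_ds snd_ws
      snd_bcw_prefixes snd_ret
    unfolding d_def by simp
qed

text \<open>Rotating a word of length \<open>p\<close> depends only on the amount modulo
  \<open>p\<close>. The log entry records the word but not the amount, so the logs agree as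
  well.\<close>

lemma bcw_shifts_mod: "length d = p \<Longrightarrow> bcw_shifts q n d = bcw_shifts (q mod p) n d"
proof (induction n arbitrary: d)
  case (Suc n)
  have "cyclic_permutation q d = cyclic_permutation (q mod p) d"
    using Suc.prems rotate_conv_mod[of q d] by (simp add: cyclic_permutation_def)
  then show ?case using Suc by (simp add: andthen_def cyclic_permutation_def)
qed simp

lemma bcw_precomputation_mod:
  assumes "p \<ge> 2"
  shows "bcw_precomputation p q r = bcw_precomputation p (q mod p) r"
  unfolding bcw_precomputation_def using assms by (subst bcw_shifts_mod[where p = p]) auto

section \<open>Results and log of the computation phase\<close>

lemma fst_append_copies: "fst (append_copies n w b) = b @ concat (replicate n w)"
  by (induction n arbitrary: b) (simp_all add: concatenation_def)

lemma snd_append_copies: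
  "snd (append_copies n w b) = map (\<lambda>i. Concatenation (b @ concat (replicate i w)) w) [0..<n]"
  by (induction n arbitrary: b) (simp_all add: concatenation_def map_upt_Suc del: upt_Suc)

lemma fst_append_blocks:
  "fst (append_blocks s xs b) = b @ concat (map (\<lambda>x. concat (replicate s (fst x)) @ snd x) xs)"
  by (induction xs arbitrary: b) (simp_all add: concatenation_def fst_append_copies)

lemma length_snd_append_blocks: "length (snd (append_blocks s xs b)) = length xs * (s + 1)"
  by (induction xs arbitrary: b) (simp_all add: concatenation_def snd_append_copies)

text \<open>Position \<open>k\<close> lies in block \<open>k div q\<close> at offset
  \<open>k mod q\<close>. This is applied to the copies of length \<open>p\<close> inside a block
  and to the blocks of length \<open>q\<close>.\<close>

lemma concat_map_upt:
  "concat (map (\<lambda>i. map (f i) [0..<q]) [0..<m]) = map (\<lambda>k. f (k div q) (k mod q)) [0..<m * q]"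
proof (induction m)
  case (Suc m)
  have "[0..<Suc m * q] = [0..<m * q] @ map (\<lambda>k. k + m * q) [0..<q]"
    using upt_add_eq_append[of 0 "m * q" q] by (simp add: map_add_upt add.commute)
  with Suc show ?case by (simp add: comp_def)
qed simp

text \<open>The final prefix starts at \<open>q div p * p\<close>, a multiple of the period
  \<open>p\<close>, so it continues the periodic sequence without a break.\<close>

lemma omega_block:
  assumes "p > 0"
  shows "concat (replicate (q div p) (omega_word p q i)) @ take (q mod p) (omega_word p q i)
    = map (omega_letter p q i) [0..<q]"
proof -
  have "concat (replicate (q div p) (omega_word p q i))
      = map (omega_letter p q i) [0..<q div p * p]"
    using concat_map_upt[of "\<lambda>_. omega_letter p q i" p "q div p"]
    by (simp add: omega_word_def omega_letter_mod map_replicate_const)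
  moreover have "take (q mod p) (omega_word p q i)
      = map (omega_letter p q i) [q div p * p..<q]"
  proof (rule nth_equalityI)
    fix k assume "k < length (take (q mod p) (omega_word p q i))"
    then have k: "k < q mod p" "k < p" by auto
    have "omega_letter p q i k = omega_letter p q i (q div p * p + k)"
      using k omega_letter_mod[of p q i "q div p * p + k"] by simp
    then show "take (q mod p) (omega_word p q i) ! k = map (omega_letter p q i) [q div p * p..<q] ! k"
      using k by (simp add: omega_word_def flip: minus_div_mult_eq_mod)
  qed (use assms in \<open>simp add: min_absorb2 minus_div_mult_eq_mod less_imp_le\<close>)
  moreover have "[0..<q] = [0..<q div p * p] @ [q div p * p..<q]"
    using upt_add_eq_append[of 0 "q div p * p" "q mod p"] by simp
  ultimately show ?thesis by simp
qed

section \<open>Correctness of the output\<close>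

text \<open>Since \<open>m < p * q\<close>, the condition \<open>j < p\<close> follows from
  \<open>j * q \<le> m\<close>, so \<open>j\<close> runs up to \<open>m div q\<close>. Reversing
  this range turns \<open>m - j * q\<close> into \<open>m mod q + j * q\<close>.\<close>

lemma coeff_cyclotomic_poly_eq_omega_letter:
  assumes "prime p" "prime q" "p \<noteq> q" "m < p * q"
  shows "coeff (cyclotomic_poly (p * q)) m = of_int (omega_letter p q (m div q) (m mod q))"
proof -
  have q: "q > 0" using assms prime_gt_0_nat by blast
  have i: "m div q < p" using assms by (simp add: less_mult_imp_div_less)
  have "{j. j < p \<and> j * q \<le> m} = {..m div q}"
    using i q by (auto simp flip: less_eq_div_iff_mult_less_eq)
  then have "(\<Sum>j | j < p \<and> j * q \<le> m. base_letter p (m - j * q))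
      = (\<Sum>j\<le>m div q. base_letter p (m - j * q))" by simp
  also have "\<dots> = (\<Sum>j\<le>m div q. base_letter p (m - (m div q - j) * q))"
    by (rule sum.reindex_bij_witness[of _ "\<lambda>j. m div q - j" "\<lambda>j. m div q - j"]) auto
  also have "\<dots> = omega_letter p q (m div q) (m mod q)"
    unfolding omega_letter_def
  proof (intro sum.cong refl arg_cong[where f = "base_letter p"])
    fix j assume "j \<in> {..m div q}"
    then have "m div q * q = (m div q - j) * q + j * q"
      by (simp flip: add_mult_distrib)
    with div_mult_mod_eq[of m q] show "m - (m div q - j) * q = m mod q + j * q" by linarith
  qed
  finally show ?thesis by (simp add: coeff_cyclotomic_poly_prime_mult[OF assms(1-3)])
qed

lemma length_concat_replicate:
  "length v = p \<Longrightarrow> length (concat (replicate n v)) = n * p"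
  by (simp add: length_concat sum_list_replicate)

lemma bcw_inputsD:
  assumes "(p, q, s, r) \<in> bcw_inputs"
  shows "prime p" "prime q" "p < q" "p \<ge> 2" "coprime p q" "s = q div p" "r = q mod p" "r < p" "s \<ge> 1"
    "s * p + r = q"
proof -
  show p: "prime p" "prime q" "p < q" "s = q div p" "r = q mod p"
    using assms by (auto simp: bcw_inputs_def)
  then show "p \<ge> 2" using prime_ge_2_nat by blast
  with p show "coprime p q" "r < p" "s * p + r = q" "s \<ge> 1"
    using primes_coprime[of p q] by (auto simp: Suc_le_eq div_greater_zero_iff)
qed

lemma bcw_correct:
  assumes "(p, q, s, r) \<in> bcw_inputs"
  shows "map of_int (fst (bcw p q s r)) = cyclotomic_word (p * q)"
proof -
  note i = bcw_inputsD[OF assms]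
  have "fst (append_blocks s (fst (bcw_precomputation p q r)) [])
      = concat (map (\<lambda>i. map (omega_letter p q i) [0..<q]) [0..<p - 1])"
    using i by (simp add: fst_append_blocks bcw_precomputation_eq comp_def omega_block)
  also have "\<dots> = map (\<lambda>k. omega_letter p q (k div q) (k mod q)) [0..<(p - 1) * q]"
    by (rule concat_map_upt)
  finally have blocks: "fst (append_blocks s (fst (bcw_precomputation p q r)) []) = \<dots>" .
  have "totient (p * q) = (p - 1) * (q - 1)"
    using i by (simp add: totient_mult_coprime totient_prime)
  \<comment> \<open>This substitution removes truncated subtraction from the identity (p-1)q - (p-2)
    = (p-1)(q-1) + 1, by which deleting \<open>p - 2\<close> letters leaves the right
    length.\<close>
  moreover obtain a b where "p = a + 2" "q = b + 2"
    using i by (metis add.commute le_Suc_ex less_imp_le order_trans)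
  ultimately have len: "(p - 1) * q - (p - 2) = totient (p * q) + 1"
    by (simp add: algebra_simps)
  have "fst (bcw p q s r)
      = map (\<lambda>k. omega_letter p q (k div q) (k mod q)) [0..<totient (p * q) + 1]"
    unfolding len[symmetric]
    by (simp add: bcw_def bcw_computation_def suffix_deletion_def blocks take_map del: upt_Suc)
  moreover have "k < p * q" if "k < totient (p * q) + 1" for k
  proof -
    have "totient (p * q) + 1 \<le> (p - 1) * q" using len by linarith
    also have "\<dots> \<le> p * q" by simp
    finally show ?thesis using that by linarith
  qed
  ultimately show ?thesis
    using i coeff_cyclotomic_poly_eq_omega_letter[of p q]
    by (auto simp: cyclotomic_word_def simp del: upt_Suc)
qed

section \<open>Every logged operation is covered by the cost model\<close>

text \<open>Together with primality of \<open>p\<close>, this is membership in the set over which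
  \<open>cost_model\<close> asserts its bounds.\<close>

definition admissible_op :: "nat \<Rightarrow> word_op \<Rightarrow> bool" where
  "admissible_op p x \<longleftrightarrow> op_length x \<le> p \<and> op_words x \<subseteq> lists alphabet"

lemma concat_replicate_in_lists: "w \<in> lists A \<Longrightarrow> concat (replicate n w) \<in> lists A"
  by (auto simp: in_lists_conv_set)

text \<open>The accumulated word is itself an operand, so its alphabet is carried along as an
  invariant. Its length may exceed \<open>p\<close>, as \<open>op_length\<close> of a concatenation
  counts only the appended word.\<close>

lemma admissible_op_append_blocks:
  assumes "b \<in> lists alphabet"
    and "\<And>x. x \<in> set xs \<Longrightarrow> fst x \<in> lists alphabet \<and> length (fst x) \<le> p"
    and "\<And>x. x \<in> set xs \<Longrightarrow> snd x \<in> lists alphabet \<and> length (snd x) \<le> p"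
  shows "fst (append_blocks s xs b) \<in> lists alphabet \<and>
    (\<forall>y \<in> set (snd (append_blocks s xs b)). admissible_op p y)"
  using assms
proof (induction xs arbitrary: b)
  case (Cons x xs)
  have cr: "b @ concat (replicate n (fst x)) \<in> lists alphabet" for n
    using Cons.prems concat_replicate_in_lists[of "fst x" alphabet n] by simp
  have "fst (append_blocks s xs (b @ concat (replicate s (fst x)) @ snd x)) \<in> lists alphabet \<and>
    (\<forall>y \<in> set (snd (append_blocks s xs (b @ concat (replicate s (fst x)) @ snd x))). admissible_op p y)"
    using cr[of s] Cons.prems by (intro Cons.IH) auto
  moreover have "admissible_op p (Concatenation (b @ concat (replicate n (fst x))) v)"
    if "v = fst x \<or> v = snd x" for n v
    using cr[of n] Cons.prems(2,3)[of x] that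
    by (auto simp: admissible_op_def simp del: append_in_lists_conv in_listsI in_lists_conv_set)
  ultimately show ?case
    by (simp add: concatenation_def fst_append_copies snd_append_copies ball_Un)
qed simp

lemma admissible_op_bcw_precomputation:
  assumes "(p, q, s, r) \<in> bcw_inputs" "x \<in> set (snd (bcw_precomputation p q r))"
  shows "admissible_op p x"
proof -
  note i = bcw_inputsD[OF assms(1)]
  have base [simp]: "base_letter p m \<in> alphabet" for m
    by (simp add: base_letter_def alphabet_def)
  have omega [simp]: "a \<in> alphabet" if "a \<in> set (omega_word p q j)" "j < p" for a j
    using set_omega_word[OF \<open>coprime p q\<close> that(2)] that(1) by blast
  consider
      j where "x = Cyclic_Permutation (map (\<lambda>k. base_letter p (k + j * q)) [0..<p])"
    | j where "j < p - 2"
        "x = Internal_Addition (omega_word p q j) (map (\<lambda>k. base_letter p (k + Suc j * q)) [0..<p])"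
    | j where "j < p - 1" "x = Truncation r (omega_word p q j)"
    using assms(2) unfolding bcw_precomputation_eq(2)[OF \<open>p \<ge> 2\<close>] set_append set_map set_upt
    by fastforce
  then show ?thesis
    by cases (simp_all add: admissible_op_def in_lists_conv_set)
qed

lemma admissible_op_bcw_computation:
  assumes "(p, q, s, r) \<in> bcw_inputs"
    and "x \<in> set (snd (bcw_computation p s (fst (bcw_precomputation p q r))))"
  shows "admissible_op p x"
proof -
  note i = bcw_inputsD[OF assms(1)]
  let ?bl = "append_blocks s (fst (bcw_precomputation p q r)) []"
  have "fst ?bl \<in> lists alphabet \<and> (\<forall>y \<in> set (snd ?bl). admissible_op p y)"
  proof (rule admissible_op_append_blocks)
    fix x assume "x \<in> set (fst (bcw_precomputation p q r))"
    then have "\<exists>j\<in>{0..<p - 1}. x = (omega_word p q j, take r (omega_word p q j))"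
      by (simp add: bcw_precomputation_eq(1)[OF i(4)] image_iff)
    then obtain j where "j \<in> {0..<p - 1}" and j: "x = (omega_word p q j, take r (omega_word p q j))"
      by blast
    then have "j < p" by simp
    show "fst x \<in> lists alphabet \<and> length (fst x) \<le> p"
      and "snd x \<in> lists alphabet \<and> length (snd x) \<le> p"
      using set_omega_word[OF \<open>coprime p q\<close> \<open>j < p\<close>] by (auto simp: j dest!: in_set_takeD)
  qed simp
  \<comment> \<open>The final deletion has \<open>op_length\<close> equal to \<open>p - 2\<close>,
    however long the word is.\<close>
  then show ?thesis
    using assms(2) by (auto simp: bcw_computation_def suffix_deletion_def admissible_op_def)
qed

section \<open>From operation counts to cost bounds\<close>

lemma length_snd_bcw_precomputation:
  "p \<ge> 2 \<Longrightarrow> length (snd (bcw_precomputation p q r)) = 3 * p - 5"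
  by (simp add: bcw_precomputation_eq)

lemma length_snd_bcw_computation:
  "p \<ge> 2 \<Longrightarrow> length (snd (bcw_computation p s (fst (bcw_precomputation p q r)))) = (p - 1) * (s + 1) + 1"
  by (simp add: bcw_computation_def suffix_deletion_def length_snd_append_blocks bcw_precomputation_eq)

text \<open>Over a principal filter "eventually" means everywhere on \<open>S\<close>, so the two
  constants must work at every point.\<close>

lemma bigtheta_principalI:
  fixes f g :: "'a \<Rightarrow> real"
  assumes "c > 0" "C > 0"
    and "\<And>x. x \<in> S \<Longrightarrow> 0 \<le> g x \<and> c * g x \<le> f x \<and> f x \<le> C * g x"
  shows "f \<in> \<Theta>[principal S](g)"
proof (rule bigthetaI)
  have nonneg: "0 \<le> f x" if "x \<in> S" for x
    using assms(1) assms(3)[OF that] by (meson mult_nonneg_nonneg less_imp_le order_trans)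
  show "f \<in> O[principal S](g)"
    using assms(2,3) nonneg by (intro landau_o.bigI[of C]) (auto simp: eventually_principal)
  show "f \<in> \<Omega>[principal S](g)"
    using assms(1,3) nonneg
    by (intro landau_omega.bigI[of c]) (auto simp: eventually_principal)
qed

text \<open>The cost model yields constants \<open>c\<close> and \<open>C\<close>, independent of
  \<open>p\<close> and of the operation; summing over a log preserves both.\<close>

lemma total_cost_bigtheta:
  fixes P :: "'i \<Rightarrow> nat" and M :: "'i \<Rightarrow> 'a logged"
  assumes "cost_model cost"
    and "\<And>i. i \<in> S \<Longrightarrow> prime (P i)"
    and "\<And>i x. i \<in> S \<Longrightarrow> x \<in> set (snd (M i)) \<Longrightarrow> admissible_op (P i) x"
  shows "(\<lambda>i. real (total_cost cost (P i) (M i)))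
    \<in> \<Theta>[principal S](\<lambda>i. real (P i * length (snd (M i))))"
proof -
  let ?D = "{(p, x). prime p \<and> op_length x \<le> p \<and> op_words x \<subseteq> lists alphabet}"
  have th: "(\<lambda>(p, x). real (cost p x)) \<in> \<Theta>[principal ?D](\<lambda>(p, x). real p)"
    using assms(1) by (simp add: cost_model_def)
  obtain C where C: "C > 0" "\<And>p x. prime p \<Longrightarrow> admissible_op p x \<Longrightarrow> real (cost p x) \<le> C * real p"
  proof -
    from landau_o.bigE[OF bigthetaD1[OF th]] obtain C where C: "C > 0"
      "eventually (\<lambda>i. norm ((\<lambda>(p, x). real (cost p x)) i) \<le> C * norm ((\<lambda>(p, x). real p) i)) (principal ?D)"
      by blast
    show thesis
    proof (rule that[OF C(1)])
      fix p x assume "prime p" "admissible_op p x"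
      then have "(p, x) \<in> ?D" by (simp add: admissible_op_def)
      with C(2) show "real (cost p x) \<le> C * real p"
        unfolding eventually_principal by fastforce
    qed
  qed
  obtain c where c: "c > 0" "\<And>p x. prime p \<Longrightarrow> admissible_op p x \<Longrightarrow> c * real p \<le> real (cost p x)"
  proof -
    from landau_omega.bigE[OF bigthetaD2[OF th]] obtain c where c: "c > 0"
      "eventually (\<lambda>i. norm ((\<lambda>(p, x). real (cost p x)) i) \<ge> c * norm ((\<lambda>(p, x). real p) i)) (principal ?D)"
      by blast
    show thesis
    proof (rule that[OF c(1)])
      fix p x assume "prime p" "admissible_op p x"
      then have "(p, x) \<in> ?D" by (simp add: admissible_op_def)
      with c(2) show "c * real p \<le> real (cost p x)"
        unfolding eventually_principal by fastforce
    qed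
  qed
  have sum_le: "real (\<Sum>x\<leftarrow>xs. cost p x) \<le> C * (p * length xs) \<and>
      c * (p * length xs) \<le> real (\<Sum>x\<leftarrow>xs. cost p x)"
    if "prime p" "\<forall>x\<in>set xs. admissible_op p x" for p xs
    using that
  proof (induction xs)
    case (Cons x xs)
    then show ?case using C(2)[of p x] c(2)[of p x] by (simp add: algebra_simps)
  qed simp
  show ?thesis
    using sum_le assms(2,3) by (intro bigtheta_principalI[OF c(1) C(1)]) (auto simp: total_cost_def)
qed

section \<open>Counting concatenations of words of length p\<close>

lemma num_concatenations_andthen:
  "num_concatenations P (m \<bind>\<^sub>l f) = num_concatenations P m + num_concatenations P (f (fst m))"
  by (simp add: num_concatenations_def)

lemma num_concatenations_concatenation:
  "num_concatenations P (concatenation u v) = (if P u v then 1 else 0)"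
  by (simp add: num_concatenations_def concatenation_def)

lemma num_concatenations_append_copies_all:
  assumes "\<And>u. length b \<le> length u \<Longrightarrow> P u w"
  shows "num_concatenations P (append_copies n w b) = n"
  using assms by (simp add: num_concatenations_def snd_append_copies filter_map comp_def)

lemma num_concatenations_append_copies_none:
  assumes "\<And>i. i < n \<Longrightarrow> \<not> P (b @ concat (replicate i w)) w"
  shows "num_concatenations P (append_copies n w b) = 0"
  using assms by (auto simp: num_concatenations_def snd_append_copies filter_map comp_def filter_empty_conv)

text \<open>The accumulated word only grows, so a condition valid for all words at least as long as
  \<open>b\<close> applies to every later concatenation. Each block then counts its \<open>s\<close>
  copies and not its prefix.\<close>

lemma num_concatenations_append_blocks:
  assumes "\<And>x u. x \<in> set xs \<Longrightarrow> length b \<le> length u \<Longrightarrow> P u (fst x) \<and> \<not> P u (snd x)"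
  shows "num_concatenations P (append_blocks s xs b) = s * length xs"
  using assms
proof (induction xs arbitrary: b)
  case Nil
  then show ?case by (simp add: num_concatenations_def)
next
  case (Cons x xs)
  have "num_concatenations P (append_copies s (fst x) b) = s"
    using Cons.prems by (intro num_concatenations_append_copies_all) auto
  moreover have "num_concatenations P
      (append_blocks s xs (b @ concat (replicate s (fst x)) @ snd x)) = s * length xs"
    using Cons.prems by (intro Cons.IH) auto
  ultimately show ?case
    using Cons.prems[of x "b @ concat (replicate s (fst x))"]
    by (simp add: num_concatenations_andthen num_concatenations_concatenation fst_append_copies)
      (simp add: concatenation_def)
qed

lemma num_concatenations_bcw_computation:
  "num_concatenations P (bcw_computation p s xs) = num_concatenations P (append_blocks s xs [])"
  unfolding bcw_computation_def num_concatenations_andthen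
  by (simp add: num_concatenations_def suffix_deletion_def)

text \<open>Prefixes have length \<open>r < p\<close> and are never counted. The count
  \<open>s * (p - 2)\<close> omits the \<open>s\<close> copies that build the first block; the
  second count includes them.\<close>

lemma num_concatenations_bcw:
  assumes "(p, q, s, r) \<in> bcw_inputs"
  defines "phase \<equiv> bcw_computation p s (fst (bcw_precomputation p q r))"
  shows "num_concatenations (\<lambda>u v. length v = p \<and> q \<le> length u) phase = s * (p - 2)"
    and "num_concatenations (\<lambda>u v. length v = p) phase = s * (p - 1)"
proof -
  note i = bcw_inputsD[OF assms(1)]
  define x where "x i = (omega_word p q i, take r (omega_word p q i))" for i
  have pre: "fst (bcw_precomputation p q r) = map x [0..<p - 1]"
    using i by (simp add: bcw_precomputation_eq x_def)
  show "num_concatenations (\<lambda>u v. length v = p) phase = s * (p - 1)"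
    unfolding phase_def num_concatenations_bcw_computation pre
    using i(4,8) by (subst num_concatenations_append_blocks) (auto simp: x_def)
  let ?P = "\<lambda>u v. length v = p \<and> q \<le> length u"
  have Cons: "map x [0..<p - 1] = x 0 # map x [Suc 0..<p - 1]"
    using i by (simp add: upt_conv_Cons)
  \<comment> \<open>Inside the first block the accumulated word has length \<open>k * p\<close> with
    \<open>k < s\<close>, below the threshold \<open>q\<close>.\<close>
  have "\<not> q \<le> k * p" if "k < s" for k
  proof -
    have "k * p < s * p" using that i(4) by simp
    then show ?thesis using i(10) by linarith
  qed
  then have "num_concatenations ?P (append_copies s (fst (x 0)) []) = 0"
    by (intro num_concatenations_append_copies_none) (simp add: x_def length_concat_replicate)
  \<comment> \<open>The completed first block has length \<open>s * p + r = q\<close>, so from here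
    on the threshold is always met.\<close>
  moreover have "num_concatenations ?P (append_blocks s (map x [Suc 0..<p - 1])
      (concat (replicate s (fst (x 0))) @ snd (x 0))) = s * (p - 2)"
    using i(4,8,10) by (subst num_concatenations_append_blocks) (auto simp: x_def length_concat_replicate)
  ultimately show "num_concatenations ?P phase = s * (p - 2)"
    unfolding phase_def num_concatenations_bcw_computation pre Cons using i(4,8)
    by (simp add: num_concatenations_andthen num_concatenations_concatenation fst_append_copies x_def)
      (simp add: concatenation_def)
qed

section \<open>Explicit constants and the final estimates\<close>

text \<open>With \<open>k = 3 * p - 5\<close> and \<open>l = (p - 1) * (s + 1) + 1\<close>, the
  lower bounds use \<open>p \<ge> 2\<close> and \<open>q \<le> p * (s + 1)\<close>. The upper bound
  on \<open>l\<close> uses \<open>s \<ge> 1\<close>, that is \<open>s + 1 \<le> 2 * s\<close>, and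
  \<open>s * p \<le> q\<close>.\<close>

lemma bcw_log_length_bounds:
  assumes "(p, q, s, r) \<in> bcw_inputs"
  defines "k \<equiv> length (snd (bcw_precomputation p q r))"
    and "l \<equiv> length (snd (bcw_computation p s (fst (bcw_precomputation p q r))))"
  shows "p\<^sup>2 \<le> 2 * (p * k)" "p * k \<le> 3 * p\<^sup>2"
    and "p * q \<le> 2 * (p * l)" "p * l \<le> 2 * (p * q)" "p * k \<le> 3 * (p * q)"
proof -
  note i = bcw_inputsD[OF assms(1)]
  have k: "k = 3 * p - 5" and l: "l = (p - 1) * (s + 1) + 1"
    using i(4) by (simp_all add: k_def l_def length_snd_bcw_precomputation length_snd_bcw_computation)
  have "p \<le> 2 * k" and "k \<le> 3 * p" using i(4) k by simp_all
  from mult_le_mono2[OF this(1), of p] mult_le_mono2[OF this(2), of p]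
  show "p\<^sup>2 \<le> 2 * (p * k)" and k_le: "p * k \<le> 3 * p\<^sup>2"
    by (simp_all add: power2_eq_square)
  have "p * p \<le> p * q" using i(3) by simp
  with k_le show "p * k \<le> 3 * (p * q)" unfolding power2_eq_square by linarith
  have "q \<le> p * (s + 1)" using i(8,10) by (simp add: algebra_simps)
  also have "\<dots> \<le> (2 * (p - 1)) * (s + 1)" using i(4) by (intro mult_le_mono1) simp
  also have "\<dots> \<le> 2 * l" by (simp add: l)
  finally show "p * q \<le> 2 * (p * l)" using mult_le_mono2[of q "2 * l" p] by simp
  have "l \<le> (p - 1) * (s + 1) + (s + 1)" by (simp add: l)
  also have "\<dots> = p * (s + 1)" using i(4) by (cases p) simp_all
  also have "\<dots> \<le> p * (2 * s)" using i(9) by (intro mult_le_mono2) simp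
  also have "\<dots> \<le> 2 * q" using i(10) by (simp add: mult.commute)
  finally show "p * l \<le> 2 * (p * q)" using mult_le_mono2[of l "2 * q" p] by simp
qed

text \<open>Shared by the two phases and the whole algorithm, with \<open>g\<close> equal to
  \<open>p^2\<close> or \<open>p * q\<close>. The constant 5 is 3 + 2, from adding the upper bounds
  of the two phases.\<close>

lemma bcw_cost_bigtheta:
  fixes M :: "nat \<Rightarrow> nat \<Rightarrow> nat \<Rightarrow> nat \<Rightarrow> 'a logged" and g :: "nat \<Rightarrow> nat \<Rightarrow> nat"
  assumes "cost_model cost"
    and "\<And>p q s r x. (p, q, s, r) \<in> bcw_inputs \<Longrightarrow> x \<in> set (snd (M p q s r)) \<Longrightarrow> admissible_op p x"
    and "\<And>p q s r. (p, q, s, r) \<in> bcw_inputs \<Longrightarrow>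
      g p q \<le> 2 * (p * length (snd (M p q s r))) \<and> p * length (snd (M p q s r)) \<le> 5 * g p q"
  shows "(\<lambda>(p, q, s, r). real (total_cost cost p (M p q s r)))
    \<in> \<Theta>[principal bcw_inputs](\<lambda>(p, q, s, r). real (g p q))"
proof -
  define N where "N = (\<lambda>(p, q, s, r). M p q s r)"
  have "(\<lambda>i. real (total_cost cost (fst i) (N i)))
      \<in> \<Theta>[principal bcw_inputs](\<lambda>i. real (fst i * length (snd (N i))))"
    by (rule total_cost_bigtheta[OF assms(1)])
      (auto simp: N_def dest: bcw_inputsD(1) intro: assms(2))
  also have "(\<lambda>i. real (fst i * length (snd (N i))))
      \<in> \<Theta>[principal bcw_inputs](\<lambda>(p, q, s, r). real (g p q))"
  proof (rule bigtheta_principalI[of "1/2" 5])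
    fix i assume "i \<in> bcw_inputs"
    moreover obtain p q s r where "i = (p, q, s, r)" by (cases i)
    ultimately show "0 \<le> (\<lambda>(p, q, s, r). real (g p q)) i \<and>
        1/2 * (\<lambda>(p, q, s, r). real (g p q)) i \<le> real (fst i * length (snd (N i))) \<and>
        real (fst i * length (snd (N i))) \<le> 5 * (\<lambda>(p, q, s, r). real (g p q)) i"
      using assms(3)[of p q s r] by (simp add: N_def flip: of_nat_mult)
  qed simp_all
  finally show ?thesis by (simp add: N_def case_prod_unfold)
qed

theorem theorem2:
  fixes cost :: "nat \<Rightarrow> word_op \<Rightarrow> nat"
  assumes "cost_model cost"
  shows
    "(\<forall>(p, q, s, r) \<in> bcw_inputs. map of_int (fst (bcw p q s r)) = cyclotomic_word (p * q))
   \<and> (\<lambda>(p, q, s, r). real (total_cost cost p (bcw p q s r)))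
        \<in> \<Theta>[principal bcw_inputs](\<lambda>(p, q, s, r). real (p * q))
   \<and> (\<exists>F. \<forall>(p, q, s, r) \<in> bcw_inputs. bcw_precomputation p q r = F p r)
   \<and> (\<lambda>(p, q, s, r). real (total_cost cost p (bcw_precomputation p q r)))
        \<in> \<Theta>[principal bcw_inputs](\<lambda>(p, q, s, r). real (p ^ 2))
   \<and> (\<forall>(p, q, s, r) \<in> bcw_inputs.
        let comp = bcw_computation p s (fst (bcw_precomputation p q r)) in
          num_concatenations (\<lambda>u v. length v = p \<and> q \<le> length u) comp = s * (p - 2)
        \<and> num_concatenations (\<lambda>u v. length v = p) comp = s * (p - 1))
   \<and> (\<lambda>(p, q, s, r).
          real (total_cost cost p (bcw_computation p s (fst (bcw_precomputation p q r)))))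
        \<in> \<Theta>[principal bcw_inputs](\<lambda>(p, q, s, r). real (p * q))"
proof (intro conjI)
  show "\<forall>(p, q, s, r) \<in> bcw_inputs. map of_int (fst (bcw p q s r)) = cyclotomic_word (p * q)"
    using bcw_correct by blast
  show "\<exists>F. \<forall>(p, q, s, r) \<in> bcw_inputs. bcw_precomputation p q r = F p r"
  proof -
    \<comment> \<open>The witness \<open>F\<close> runs the precomputation with \<open>r\<close> in
      place of \<open>q\<close>.\<close>
    have "bcw_precomputation p q r = bcw_precomputation p r r" if "(p, q, s, r) \<in> bcw_inputs" for p q s r
      using bcw_precomputation_mod[OF bcw_inputsD(4)[OF that]] bcw_inputsD(7)[OF that] by metis
    then show ?thesis by (intro exI[of _ "\<lambda>p r. bcw_precomputation p r r"]) blast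
  qed
  show "\<forall>(p, q, s, r) \<in> bcw_inputs.
        let comp = bcw_computation p s (fst (bcw_precomputation p q r)) in
          num_concatenations (\<lambda>u v. length v = p \<and> q \<le> length u) comp = s * (p - 2)
        \<and> num_concatenations (\<lambda>u v. length v = p) comp = s * (p - 1)"
    using num_concatenations_bcw unfolding Let_def by blast
  have log: "snd (bcw p q s r) = snd (bcw_precomputation p q r) @
      snd (bcw_computation p s (fst (bcw_precomputation p q r)))" for p q s r
    by (simp add: bcw_def)
  show "(\<lambda>(p, q, s, r). real (total_cost cost p (bcw p q s r)))
        \<in> \<Theta>[principal bcw_inputs](\<lambda>(p, q, s, r). real (p * q))"
  proof (rule bcw_cost_bigtheta[OF assms])
    fix p q s r assume "(p, q, s, r) \<in> bcw_inputs"
    from bcw_log_length_bounds(3-5)[OF this]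
    show "p * q \<le> 2 * (p * length (snd (bcw p q s r))) \<and> p * length (snd (bcw p q s r)) \<le> 5 * (p * q)"
      unfolding log length_append distrib_left by linarith
  qed (auto simp: log intro: admissible_op_bcw_precomputation admissible_op_bcw_computation)
  show "(\<lambda>(p, q, s, r). real (total_cost cost p (bcw_precomputation p q r)))
        \<in> \<Theta>[principal bcw_inputs](\<lambda>(p, q, s, r). real (p ^ 2))"
  proof (rule bcw_cost_bigtheta[OF assms])
    fix p q s r assume "(p, q, s, r) \<in> bcw_inputs"
    from bcw_log_length_bounds(1,2)[OF this]
    show "p\<^sup>2 \<le> 2 * (p * length (snd (bcw_precomputation p q r))) \<and>
        p * length (snd (bcw_precomputation p q r)) \<le> 5 * p\<^sup>2"
      by linarith
  qed (rule admissible_op_bcw_precomputation)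
  show "(\<lambda>(p, q, s, r).
          real (total_cost cost p (bcw_computation p s (fst (bcw_precomputation p q r)))))
        \<in> \<Theta>[principal bcw_inputs](\<lambda>(p, q, s, r). real (p * q))"
  proof (rule bcw_cost_bigtheta[OF assms])
    fix p q s r assume "(p, q, s, r) \<in> bcw_inputs"
    from bcw_log_length_bounds(3,4)[OF this]
    show "p * q \<le> 2 * (p * length (snd (bcw_computation p s (fst (bcw_precomputation p q r))))) \<and>
        p * length (snd (bcw_computation p s (fst (bcw_precomputation p q r)))) \<le> 5 * (p * q)"
      by linarith
  qed (rule admissible_op_bcw_computation)
qed

end
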